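(* Every maximizer $(\boldsymbol\phi^*,\boldsymbol\psi^* )\in\mathcal A_C$ of $J_\epsilon$ over $\mathcal A_C$ satisfies $$\phi_i^*=\mathcal T_i\psi_i^*,\qquad\psi_i^*=\mathcal B_i(\boldsymbol\phi^* ),\qquad i=1,\dots,p.$$ Consequently, for all $i$, all $x,x'\in X_i$ and all $y,y'\in Y$, $$|\phi_i^*(x)-\phi_i^*(x')|\le\sup_{y\in Y}|c_i(x,y)-c_i(x',y)|,$$ $$|\psi_i^*(y)-\psi_i^*(y')|\le\omega_i^Y(y,y')+\sum_{j=1}^p\lambda_j\,\omega_j^Y(y,y').$$ In particular, if for every $i$ the cost $c_i$ is $L_i^X$-Lipschitz in its first variable (uniformly in the second) and $L_i^Y$-Lipschitz in its second variable (uniformly in the first), then, for every $i$, $\phi_i^*$ is $L_i^X$-Lipschitz and $\psi_i^*$ is $\bigl(L_i^Y+\sum_{j=1}^p\lambda_jL_j^Y\bigr)$-Lipschitz.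
   Context: Setting. Let $p\ge 2$ and $\epsilon>0$. Let $X_1,\dots,X_p$ and $Y$ be compact metric spaces; $\mathcal P(Z)$ denotes the Borel probability measures on $Z$ and $C(Z)$ the real-valued continuous functions on $Z$. For each $i$, let $\nu_i\in\mathcal P(X_i)$, $c_i\in C(X_i\times Y)$, and $\lambda_i>0$ with $\sum_{i=1}^p\lambda_i=1$. Fix $\eta\in\mathcal P(Y)$. Standing assumption: $\operatorname{spt}\nu_i=X_i$ for all $i$ and $\operatorname{spt}\eta=Y$. Set $\xi_i:=\nu_i\otimes\eta$ (product measure). $\mathcal A_C$ is the set of pairs $(\boldsymbol\phi,\boldsymbol\psi)$ with $\boldsymbol\phi=(\phi_1,\dots,\phi_p)$, $\boldsymbol\psi=(\psi_1,\dots,\psi_p)$, $\phi_i\in C(X_i)$, $\psi_i\in C(Y)$ and $\sum_{i=1}^p\lambda_i\psi_i=0$ on $Y$. The dual functional is $$J_\epsilon(\boldsymbol\phi,\boldsymbol\psi):=\sum_{i=1}^p\lambda_i\left[\int_{X_i}\phi_i\,d\nu_i-\epsilon\int_{X_i\times Y}\exp\left(\frac{\phi_i(x)+\psi_i(y)-c_i(x,y)}{\epsilon}\right)d\xi_i(x,y)\right].$$ Transforms. For $\psi\in C(Y)$ and $x\in X_i$, $(\mathcal T_i\psi)(x):=-\epsilon\log\int_Y\exp\left(\frac{\psi(y)-c_i(x,y)}{\epsilon}\right)d\eta(y)$. For $\phi_i\in C(X_i)$ and $y\in Y$, $(\mathcal S_i\phi_i)(y):=-\epsilon\log\int_{X_i}\exp\left(\frac{\phi_i(x)-c_i(x,y)}{\epsilon}\right)d\nu_i(x)$.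 For $\boldsymbol\phi=(\phi_1,\dots,\phi_p)$, $\mathcal B_i(\boldsymbol\phi):=\mathcal S_i\phi_i-\sum_{j=1}^p\lambda_j\mathcal S_j\phi_j$. Finally $\omega_i^Y(y,y'):=\sup_{x\in X_i}|c_i(x,y)-c_i(x,y')|$. *)

theory Defs
  imports "HOL-Probability.Probability"
begin

text \<open>The spaces are values of the type \<open>'a metric\<close>. Thus \<open>X :: nat \<Rightarrow> 'a metric\<close> is a family of
  metric spaces with unrelated carriers and unrelated distances; only the ambient type of
  points is shared. Functions on such a space are total HOL functions; everything below
  depends only on their values on the carriers.\<close>

definition borel_of :: "'a topology \<Rightarrow> 'a measure" where
  "borel_of T = sigma (topspace T) {U. openin T U}"

definition borel_probs :: "'a topology \<Rightarrow> 'a measure set" where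
  "borel_probs T = {M. prob_space M \<and> sets M = sets (borel_of T)}"

definition spt :: "'a topology \<Rightarrow> 'a measure \<Rightarrow> 'a set" where
  "spt T M = {x \<in> topspace T. \<forall>U. openin T U \<longrightarrow> x \<in> U \<longrightarrow> 0 < emeasure M U}"

text \<open>The Lipschitz constant is required to be nonnegative, as in \<^const>\<open>lipschitz_on\<close>.\<close>

definition lipschitz_with :: "real \<Rightarrow> 'a metric \<Rightarrow> ('a \<Rightarrow> real) \<Rightarrow> bool" where
  "lipschitz_with L m f \<longleftrightarrow>
     0 \<le> L \<and> (\<forall>x\<in>mspace m. \<forall>x'\<in>mspace m. \<bar>f x - f x'\<bar> \<le> L * mdist m x x')"

definition dual_admissible ::
  "nat \<Rightarrow> (nat \<Rightarrow> 'a metric) \<Rightarrow> 'b metric \<Rightarrow> (nat \<Rightarrow> real) \<Rightarrow>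
   ((nat \<Rightarrow> 'a \<Rightarrow> real) \<times> (nat \<Rightarrow> 'b \<Rightarrow> real)) set" where
  "dual_admissible p X Y lam = {(\<phi>, \<psi>).
     (\<forall>i\<in>{1..p}. continuous_map (mtopology_of (X i)) euclideanreal (\<phi> i)) \<and>
     (\<forall>i\<in>{1..p}. continuous_map (mtopology_of Y) euclideanreal (\<psi> i)) \<and>
     (\<forall>y\<in>mspace Y. (\<Sum>i=1..p. lam i * \<psi> i y) = 0)}"

text \<open>The measure in the second integral lives on the product sigma-algebra. For compact metric
  spaces this is the Borel sigma-algebra of the product, so continuous integrands
  are integrable.\<close>

definition dual_functional ::
  "nat \<Rightarrow> real \<Rightarrow> (nat \<Rightarrow> 'a measure) \<Rightarrow> 'b measure \<Rightarrow> (nat \<Rightarrow> 'a \<times> 'b \<Rightarrow> real) \<Rightarrow> (nat \<Rightarrow> real) \<Rightarrow>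
   (nat \<Rightarrow> 'a \<Rightarrow> real) \<times> (nat \<Rightarrow> 'b \<Rightarrow> real) \<Rightarrow> real" where
  "dual_functional p \<epsilon> \<nu> \<eta> c lam = (\<lambda>(\<phi>, \<psi>).
     \<Sum>i=1..p. lam i *
       ((\<integral>x. \<phi> i x \<partial>(\<nu> i)) -
        \<epsilon> * (\<integral>(x, y). exp ((\<phi> i x + \<psi> i y - c i (x, y)) / \<epsilon>) \<partial>(\<nu> i \<Otimes>\<^sub>M \<eta>))))"

definition T_transform ::
  "real \<Rightarrow> 'b measure \<Rightarrow> ('a \<times> 'b \<Rightarrow> real) \<Rightarrow> ('b \<Rightarrow> real) \<Rightarrow> 'a \<Rightarrow> real" where
  "T_transform \<epsilon> \<eta> c \<psi> x = - \<epsilon> * ln (\<integral>y. exp ((\<psi> y - c (x, y)) / \<epsilon>) \<partial>\<eta>)"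

definition S_transform ::
  "real \<Rightarrow> 'a measure \<Rightarrow> ('a \<times> 'b \<Rightarrow> real) \<Rightarrow> ('a \<Rightarrow> real) \<Rightarrow> 'b \<Rightarrow> real" where
  "S_transform \<epsilon> \<nu> c \<phi> y = - \<epsilon> * ln (\<integral>x. exp ((\<phi> x - c (x, y)) / \<epsilon>) \<partial>\<nu>)"

definition B_transform ::
  "nat \<Rightarrow> real \<Rightarrow> (nat \<Rightarrow> 'a measure) \<Rightarrow> (nat \<Rightarrow> 'a \<times> 'b \<Rightarrow> real) \<Rightarrow> (nat \<Rightarrow> real) \<Rightarrow>
   (nat \<Rightarrow> 'a \<Rightarrow> real) \<Rightarrow> nat \<Rightarrow> 'b \<Rightarrow> real" where
  "B_transform p \<epsilon> \<nu> c lam \<phi> i y =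
     S_transform \<epsilon> (\<nu> i) (c i) (\<phi> i) y -
     (\<Sum>j=1..p. lam j * S_transform \<epsilon> (\<nu> j) (c j) (\<phi> j) y)"

definition modulus_Y :: "'a metric \<Rightarrow> ('a \<times> 'b \<Rightarrow> real) \<Rightarrow> 'b \<Rightarrow> 'b \<Rightarrow> real" where
  "modulus_Y X c y y' = (SUP x\<in>mspace X. \<bar>c (x, y) - c (x, y')\<bar>)"

end

theory Submission
  imports Defs
begin

text \<open>No differentiation of the dual functional is needed. By Fubini, replacing one block of
  potentials by its transform increases the functional by an integral of \<open>exp u - 1 - u\<close>, up to
  positive weights. In the \<open>\<phi>\<close>-block \<open>u\<close> is \<open>(\<phi>\<^sub>i - T\<^sub>i \<psi>\<^sub>i) / \<epsilon>\<close>; in the \<open>\<psi>\<close>-block it is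
  \<open>(\<psi>\<^sub>i - B\<^sub>i(\<phi>)) / \<epsilon>\<close>, where the constraint \<open>\<Sum>\<^sub>i \<lambda>\<^sub>i \<psi>\<^sub>i = 0\<close> makes the linear terms cancel.
  At a maximizer this nonnegative continuous integrand has integral zero, so it vanishes on the
  support, which forces \<open>u = 0\<close> everywhere. The moduli of continuity follow because a soft minimum is
  monotone and commutes with adding constants.\<close>

section \<open>Integration of continuous functions on compact spaces against Borel probability
  measures\<close>

lemma space_borel_probs: "M \<in> borel_probs T \<Longrightarrow> space M = topspace T"
proof -
  assume "M \<in> borel_probs T"
  then have "sets M = sets (borel_of T)"
    by (simp add: borel_probs_def)
  then have "space M = space (borel_of T)"
    by (rule sets_eq_imp_space_eq)
  also have "\<dots> = topspace T"
    unfolding borel_of_def by (rule space_measure_of) (auto dest: openin_subset)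
  finally show ?thesis .
qed

lemma openin_sets_borel_probs:
  assumes "M \<in> borel_probs T" and "openin T U"
  shows "U \<in> sets M"
proof -
  have "U \<in> sets (borel_of T)"
    unfolding borel_of_def using assms(2) openin_subset by (subst sets_measure_of) auto
  then show ?thesis
    using assms(1) by (simp add: borel_probs_def)
qed

lemma borel_measurable_continuous_map:
  fixes f :: "'a \<Rightarrow> real"
  assumes "M \<in> borel_probs T" and "continuous_map T euclideanreal f"
  shows "f \<in> borel_measurable M"
  using assms openin_sets_borel_probs[OF assms(1)]
  by (auto simp: borel_measurable_iff_greater space_borel_probs
      continuous_map_upper_lower_semicontinuous_lt)

lemma compact_space_continuous_map_bounded:
  fixes f :: "'a \<Rightarrow> real"
  assumes "compact_space T" and "continuous_map T euclideanreal f"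
  obtains B where "\<And>x. x \<in> topspace T \<Longrightarrow> \<bar>f x\<bar> \<le> B"
proof -
  have "compact (f ` topspace T)"
    using assms image_compactin[of T "topspace T" euclideanreal f] by (simp add: compact_space_def)
  then have "bounded (f ` topspace T)"
    by (rule compact_imp_bounded)
  then show thesis
    using that by (auto simp: bounded_iff)
qed

lemma continuous_map_exp:
  fixes f :: "'a \<Rightarrow> real"
  assumes "continuous_map T euclideanreal f"
  shows "continuous_map T euclideanreal (\<lambda>x. exp (f x))"
proof -
  have "continuous_map euclideanreal euclideanreal (exp :: real \<Rightarrow> real)"
    by (simp add: continuous_on_exp)
  from continuous_map_compose[OF assms this] show ?thesis
    by (simp add: comp_def)
qed

lemma integrable_continuous_map:
  fixes f :: "'a \<Rightarrow> real"
  assumes "M \<in> borel_probs T" and "compact_space T" and "continuous_map T euclideanreal f"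
  shows "integrable M f"
proof -
  interpret prob_space M
    using assms(1) by (simp add: borel_probs_def)
  obtain B where "\<And>x. x \<in> topspace T \<Longrightarrow> \<bar>f x\<bar> \<le> B"
    using compact_space_continuous_map_bounded[OF assms(2,3)] by blast
  then show ?thesis
    using borel_measurable_continuous_map[OF assms(1,3)]
    by (intro integrable_const_bound[where B = B]) (auto simp: space_borel_probs[OF assms(1)])
qed

text \<open>Neither factor needs to be second countable: each superlevel set is a countable union of
  closed, hence compact, superlevel sets, and each of these is covered by finitely many open
  rectangles.\<close>

lemma borel_measurable_continuous_map_prod:
  fixes h :: "'a \<times> 'b \<Rightarrow> real"
  assumes M: "M \<in> borel_probs S" and N: "N \<in> borel_probs T"
    and "compact_space S" and "compact_space T"
    and h: "continuous_map (prod_topology S T) euclideanreal h"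
  shows "h \<in> borel_measurable (M \<Otimes>\<^sub>M N)"
  unfolding borel_measurable_iff_greater
proof
  fix a :: real
  let ?P = "prod_topology S T"
  define W where "W = {w \<in> topspace ?P. a < h w}"
  \<comment> \<open>The margin must be strictly positive for \<open>K n\<close> to lie inside
    \<open>W\<close>. With \<open>n\<close> in place of \<open>Suc n\<close>, the set for
    \<open>n = 0\<close> would have margin \<open>1 / 0 = 0\<close> and would contain the points
    where \<open>h w = a\<close>.\<close>
  define K where "K n = {w \<in> topspace ?P. a + 1 / real (Suc n) \<le> h w}" for n
  have oW: "openin ?P W"
    using h unfolding W_def by (simp add: continuous_map_upper_lower_semicontinuous_lt)
  define R where "R = {U \<times> V | U V. openin S U \<and> openin T V \<and> U \<times> V \<subseteq> W}"
  have Ro: "openin ?P Z" and RW: "Z \<subseteq> W" and Rm: "Z \<in> sets (M \<Otimes>\<^sub>M N)" if "Z \<in> R" for Z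
    using that openin_sets_borel_probs[OF M] openin_sets_borel_probs[OF N]
    by (auto simp: R_def openin_prod_Times_iff intro!: pair_measureI)
  have WR: "W \<subseteq> \<Union>R"
  proof
    fix w assume "w \<in> W"
    then obtain U V where "openin S U" "openin T V" "w \<in> U \<times> V" "U \<times> V \<subseteq> W"
      using oW unfolding openin_prod_topology_alt by (metis mem_Sigma_iff prod.collapse)
    then show "w \<in> \<Union>R"
      unfolding R_def by blast
  qed
  have "\<exists>F. finite F \<and> F \<subseteq> R \<and> K n \<subseteq> \<Union>F" for n
  proof -
    have "closedin ?P (K n)"
      using h unfolding K_def continuous_map_upper_lower_semicontinuous_le by blast
    then have "compactin ?P (K n)"
      using assms(3,4) by (intro closedin_compact_space) (auto simp: compact_space_prod_topology)
    moreover have "K n \<subseteq> W"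
      unfolding K_def W_def by (auto simp: less_le_trans[of a "a + 1 / real (Suc n)"])
    ultimately show ?thesis
      using Ro WR unfolding compactin_def by (meson order_trans)
  qed
  then obtain F where F: "\<And>n. finite (F n)" "\<And>n. F n \<subseteq> R" "\<And>n. K n \<subseteq> \<Union>(F n)"
    by metis
  have WK: "W \<subseteq> (\<Union>n. K n)"
  proof
    fix w assume w: "w \<in> W"
    then obtain n where "1 / real (Suc n) < h w - a"
      using reals_Archimedean[of "h w - a"] by (auto simp: W_def inverse_eq_divide)
    then show "w \<in> (\<Union>n. K n)"
      using w by (auto simp: K_def W_def intro!: exI[of _ n])
  qed
  have "W \<subseteq> (\<Union>n. \<Union>(F n))"
    using WK UN_mono[OF subset_refl F(3)] by (rule order_trans)
  moreover have "(\<Union>n. \<Union>(F n)) \<subseteq> W"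
    using F(2) by (intro UN_least Union_least RW) auto
  moreover have "\<Union>(F n) \<in> sets (M \<Otimes>\<^sub>M N)" for n
    using F(1)[of n] F(2)[of n] Rm by (intro sets.finite_Union) auto
  then have "(\<Union>n. \<Union>(F n)) \<in> sets (M \<Otimes>\<^sub>M N)"
    by auto
  moreover have "space (M \<Otimes>\<^sub>M N) = topspace ?P"
    by (simp add: space_pair_measure space_borel_probs[OF M] space_borel_probs[OF N])
  ultimately show "{w \<in> space (M \<Otimes>\<^sub>M N). a < h w} \<in> sets (M \<Otimes>\<^sub>M N)"
    unfolding W_def by (metis antisym)
qed

lemma integrable_continuous_map_prod:
  fixes h :: "'a \<times> 'b \<Rightarrow> real"
  assumes M: "M \<in> borel_probs S" and N: "N \<in> borel_probs T"
    and "compact_space S" and "compact_space T"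
    and h: "continuous_map (prod_topology S T) euclideanreal h"
  shows "integrable (M \<Otimes>\<^sub>M N) h"
proof -
  interpret M: prob_space M
    using M by (simp add: borel_probs_def)
  interpret N: prob_space N
    using N by (simp add: borel_probs_def)
  interpret pair_prob_space M N ..
  have "compact_space (prod_topology S T)"
    using assms by (simp add: compact_space_prod_topology)
  then obtain B where "\<And>w. w \<in> topspace (prod_topology S T) \<Longrightarrow> \<bar>h w\<bar> \<le> B"
    using compact_space_continuous_map_bounded[OF _ h] by blast
  then show ?thesis
    using borel_measurable_continuous_map_prod[OF assms]
    by (intro P.integrable_const_bound[where B = B])
      (auto simp: space_pair_measure space_borel_probs[OF M] space_borel_probs[OF N])
qed

text \<open>A nonnegative function with nonpositive integral vanishes almost everywhere. If it were
  positive at some point, it would be positive on an open neighbourhood of that point, and full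
  support gives such a set positive mass. This turns equality of integrals into equality at every
  point of the space.\<close>

lemma continuous_integral_le_0_imp_eq_0:
  fixes f :: "'a \<Rightarrow> real"
  assumes M: "M \<in> borel_probs T" and "compact_space T" and full: "spt T M = topspace T"
    and f: "continuous_map T euclideanreal f"
    and nn: "\<And>x. x \<in> topspace T \<Longrightarrow> 0 \<le> f x"
    and le: "(\<integral>x. f x \<partial>M) \<le> 0" and x: "x \<in> topspace T"
  shows "f x = 0"
proof (rule ccontr)
  assume "f x \<noteq> 0"
  define U where "U = {z \<in> topspace T. 0 < f z}"
  have U: "openin T U"
    using f unfolding U_def by (simp add: continuous_map_upper_lower_semicontinuous_lt)
  have "x \<in> U"
    using x nn[OF x] \<open>f x \<noteq> 0\<close> by (simp add: U_def)
  then have pos: "0 < emeasure M U"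
    using U x full by (auto simp: spt_def)
  have nn': "AE x in M. 0 \<le> f x"
    using nn by (auto simp: space_borel_probs[OF M])
  then have "(\<integral>x. f x \<partial>M) = 0"
    using le by (intro antisym integral_nonneg_AE)
  then have "AE x in M. f x = 0"
    using integral_nonneg_eq_0_iff_AE[OF integrable_continuous_map[OF M assms(2) f] nn'] by simp
  then have "AE x in M. x \<notin> U"
    by eventually_elim (simp add: U_def)
  moreover have "{x \<in> space M. \<not> x \<notin> U} = U"
    by (auto simp: U_def space_borel_probs[OF M])
  ultimately have "emeasure M U = 0"
    using openin_sets_borel_probs[OF M U] AE_iff_measurable[of U M "\<lambda>x. x \<notin> U"] by simp
  with pos show False
    by simp
qed

section \<open>Sections, soft minima, and the two transforms\<close>

lemma continuous_map_section:
  assumes "continuous_map (prod_topology S T) Z h" and "x \<in> topspace S"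
  shows "continuous_map T Z (\<lambda>y. h (x, y))"
  using continuous_map_compose[of T "prod_topology S T" "\<lambda>y. (x, y)" Z h] assms
  by (simp add: comp_def continuous_map_pairedI)

lemma continuous_map_prod_swap:
  assumes "continuous_map (prod_topology S T) Z h"
  shows "continuous_map (prod_topology T S) Z (\<lambda>(y, x). h (x, y))"
  using continuous_map_compose[OF _ assms, of "prod_topology T S" "\<lambda>(y, x). (x, y)"]
  by (simp add: comp_def case_prod_unfold continuous_map_pairedI continuous_map_fst continuous_map_snd)

text \<open>This is the smoothed minimum of \<open>f\<close> at temperature
  \<open>\<epsilon>\<close> (a negative log-partition function). Both transforms are soft minima of
  the cost minus the potential, so estimates need proving only once.\<close>

definition soft_min :: "real \<Rightarrow> 'a measure \<Rightarrow> ('a \<Rightarrow> real) \<Rightarrow> real" where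
  "soft_min \<epsilon> M f = - \<epsilon> * ln (\<integral>x. exp (- f x / \<epsilon>) \<partial>M)"

lemma T_transform_eq_soft_min:
  "T_transform \<epsilon> N c \<psi> x = soft_min \<epsilon> N (\<lambda>y. c (x, y) - \<psi> y)"
  by (simp add: T_transform_def soft_min_def)

text \<open>Exchanging the two factors of the cost turns one transform into the other, which carries
  continuity and moduli from \<open>T_transform\<close> over to \<open>S_transform\<close>.\<close>

lemma S_transform_eq_T_transform:
  "S_transform \<epsilon> M c \<phi> y = T_transform \<epsilon> M (\<lambda>(y, x). c (x, y)) \<phi> y"
  by (simp add: T_transform_def S_transform_def)

lemma integrable_exp_continuous_map:
  fixes f :: "'a \<Rightarrow> real"
  assumes "M \<in> borel_probs T" and "compact_space T" and "continuous_map T euclideanreal f"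
    and "0 < \<epsilon>"
  shows "integrable M (\<lambda>x. exp (- f x / \<epsilon>))"
  using assms by (intro integrable_continuous_map continuous_map_exp continuous_intros) auto

text \<open>Strict positivity is what allows \<open>exp\<close> to undo the logarithm in
  \<open>soft_min\<close>. It rests on the total mass being one, so that the whole space is not a
  null set.\<close>

lemma integral_exp_pos:
  assumes "M \<in> borel_probs T" and "integrable M (\<lambda>x. exp (f x :: real))"
  shows "0 < (\<integral>x. exp (f x) \<partial>M)"
proof -
  interpret prob_space M
    using assms(1) by (simp add: borel_probs_def)
  have "(\<integral>x. 0 \<partial>M) < (\<integral>x. exp (f x) \<partial>M)"
    using assms(2) by (intro integral_less_AE_space) (auto simp: emeasure_space_1)
  then show ?thesis
    by simp
qed

lemma exp_soft_min:
  assumes "M \<in> borel_probs T" and "compact_space T" and "continuous_map T euclideanreal f"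
    and "0 < \<epsilon>"
  shows "exp (- soft_min \<epsilon> M f / \<epsilon>) = (\<integral>x. exp (- f x / \<epsilon>) \<partial>M)"
  using integral_exp_pos[OF assms(1) integrable_exp_continuous_map[OF assms]] assms(4)
  by (simp add: soft_min_def)

text \<open>Monotonicity and commutation with constants in a single statement. The comparison is
  made after exponentiating, where adding \<open>K\<close> becomes the factor
  \<open>exp (- K / \<epsilon>)\<close> and the order is reversed.\<close>

lemma soft_min_le:
  assumes M: "M \<in> borel_probs T" and T: "compact_space T" and "0 < \<epsilon>"
    and f: "continuous_map T euclideanreal f" and g: "continuous_map T euclideanreal g"
    and le: "\<And>x. x \<in> topspace T \<Longrightarrow> f x \<le> g x + K"
  shows "soft_min \<epsilon> M f \<le> soft_min \<epsilon> M g + K"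
proof -
  have "exp (- soft_min \<epsilon> M g / \<epsilon>) * exp (- K / \<epsilon>) = (\<integral>x. exp (- g x / \<epsilon>) * exp (- K / \<epsilon>) \<partial>M)"
    using exp_soft_min[OF M T g \<open>0 < \<epsilon>\<close>] by simp
  also have "\<dots> \<le> (\<integral>x. exp (- f x / \<epsilon>) \<partial>M)"
  proof (rule integral_mono)
    show "integrable M (\<lambda>x. exp (- g x / \<epsilon>) * exp (- K / \<epsilon>))"
      using integrable_exp_continuous_map[OF M T g \<open>0 < \<epsilon>\<close>] by simp
    show "integrable M (\<lambda>x. exp (- f x / \<epsilon>))"
      by (rule integrable_exp_continuous_map[OF M T f \<open>0 < \<epsilon>\<close>])
    fix x assume "x \<in> space M"
    then have "- (g x + K) / \<epsilon> \<le> - f x / \<epsilon>"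
      using le[of x] \<open>0 < \<epsilon>\<close> by (intro divide_right_mono) (auto simp: space_borel_probs[OF M])
    then have "exp (- g x / \<epsilon> + - K / \<epsilon>) \<le> exp (- f x / \<epsilon>)"
      by (simp add: diff_divide_distrib add_divide_distrib)
    then show "exp (- g x / \<epsilon>) * exp (- K / \<epsilon>) \<le> exp (- f x / \<epsilon>)"
      by (simp only: exp_add)
  qed
  also have "\<dots> = exp (- soft_min \<epsilon> M f / \<epsilon>)"
    by (rule exp_soft_min[OF M T f \<open>0 < \<epsilon>\<close>, symmetric])
  finally have "- (soft_min \<epsilon> M g + K) / \<epsilon> \<le> - soft_min \<epsilon> M f / \<epsilon>"
    by (simp add: diff_divide_distrib add_divide_distrib flip: exp_add)
  then show ?thesis
    using \<open>0 < \<epsilon>\<close> unfolding divide_le_cancel by auto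
qed

text \<open>The potential \<open>\<psi>\<close> enters both soft minima identically and cancels in
  the comparison of their arguments. The modulus of the transform is therefore controlled by the
  cost alone.\<close>

lemma T_transform_diff_le:
  assumes N: "N \<in> borel_probs T" and T: "compact_space T" and "0 < \<epsilon>"
    and c: "continuous_map (prod_topology S T) euclideanreal c"
    and \<psi>: "continuous_map T euclideanreal \<psi>"
    and x: "x \<in> topspace S" "x' \<in> topspace S"
    and le: "\<And>y. y \<in> topspace T \<Longrightarrow> \<bar>c (x, y) - c (x', y)\<bar> \<le> K"
  shows "\<bar>T_transform \<epsilon> N c \<psi> x - T_transform \<epsilon> N c \<psi> x'\<bar> \<le> K"
proof -
  have cont: "continuous_map T euclideanreal (\<lambda>y. c (z, y) - \<psi> y)" if "z \<in> topspace S" for z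
    using continuous_map_section[OF c that] \<psi> by (rule continuous_map_diff)
  have "soft_min \<epsilon> N (\<lambda>y. c (x, y) - \<psi> y) \<le> soft_min \<epsilon> N (\<lambda>y. c (x', y) - \<psi> y) + K"
    using le by (intro soft_min_le[OF N T \<open>0 < \<epsilon>\<close>] cont x) (force simp: abs_le_iff)
  moreover have "soft_min \<epsilon> N (\<lambda>y. c (x', y) - \<psi> y) \<le> soft_min \<epsilon> N (\<lambda>y. c (x, y) - \<psi> y) + K"
    using le by (intro soft_min_le[OF N T \<open>0 < \<epsilon>\<close>] cont x) (force simp: abs_le_iff)
  ultimately show ?thesis
    by (simp add: T_transform_eq_soft_min abs_le_iff)
qed

lemma T_transform_diff_le_SUP:
  assumes N: "N \<in> borel_probs T" and T: "compact_space T" and "0 < \<epsilon>"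
    and c: "continuous_map (prod_topology S T) euclideanreal c"
    and \<psi>: "continuous_map T euclideanreal \<psi>"
    and x: "x \<in> topspace S" "x' \<in> topspace S"
  shows "\<bar>T_transform \<epsilon> N c \<psi> x - T_transform \<epsilon> N c \<psi> x'\<bar>
    \<le> (SUP y\<in>topspace T. \<bar>c (x, y) - c (x', y)\<bar>)"
proof (rule T_transform_diff_le[OF assms])
  \<comment> \<open>A real supremum is an upper bound only for a set bounded above; here compactness
    of \<open>T\<close> supplies the bound.\<close>
  have "continuous_map T euclideanreal (\<lambda>y. \<bar>c (x, y) - c (x', y)\<bar>)"
    by (intro continuous_map_real_abs continuous_map_diff continuous_map_section[OF c] x)
  then obtain B where "\<And>y. y \<in> topspace T \<Longrightarrow> \<bar>\<bar>c (x, y) - c (x', y)\<bar>\<bar> \<le> B"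
    using compact_space_continuous_map_bounded[OF T] by blast
  then have "bdd_above ((\<lambda>y. \<bar>c (x, y) - c (x', y)\<bar>) ` topspace T)"
    by (intro bdd_aboveI2[where M = B]) auto
  then show "\<bar>c (x, y) - c (x', y)\<bar> \<le> (SUP y\<in>topspace T. \<bar>c (x, y) - c (x', y)\<bar>)"
    if "y \<in> topspace T" for y
    using that by (intro cSUP_upper)
qed

text \<open>Compactness of \<open>T\<close> and the tube lemma make \<open>c (z, y)\<close> close to
  \<open>c (x, y)\<close> uniformly in \<open>y\<close> for \<open>z\<close> near \<open>x\<close>.
  The modulus estimate passes this closeness on to the transform.\<close>

lemma continuous_map_T_transform:
  assumes N: "N \<in> borel_probs T" and T: "compact_space T" and "0 < \<epsilon>"
    and c: "continuous_map (prod_topology S T) euclideanreal c"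
    and \<psi>: "continuous_map T euclideanreal \<psi>"
  shows "continuous_map S euclideanreal (T_transform \<epsilon> N c \<psi>)"
proof -
  have "\<exists>U. openin S U \<and> x \<in> U \<and>
      (\<forall>z\<in>U. T_transform \<epsilon> N c \<psi> z \<in> ball (T_transform \<epsilon> N c \<psi> x) e)"
    if x: "x \<in> topspace S" and "0 < e" for x e
  proof -
    let ?P = "prod_topology S T"
    \<comment> \<open>The tolerance is \<open>e / 2\<close> because the transform estimate yields
      only a non-strict bound, while membership in the ball is strict.\<close>
    let ?W = "{w \<in> topspace ?P. \<bar>c w - c (x, snd w)\<bar> < e / 2}"
    have "continuous_map ?P euclideanreal (\<lambda>w. \<bar>c w - c (x, snd w)\<bar>)"
      using continuous_map_compose[OF continuous_map_snd continuous_map_section[OF c x]]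
      by (intro continuous_map_real_abs continuous_map_diff c) (simp add: comp_def)
    then have "openin ?P ?W"
      unfolding continuous_map_upper_lower_semicontinuous_lt by blast
    moreover have "{x} \<times> topspace T \<subseteq> ?W"
      using x \<open>0 < e\<close> by auto
    moreover have "compactin T (topspace T)"
      using T by (simp add: compact_space_def)
    ultimately obtain U V where U: "openin S U" "x \<in> U" and "topspace T \<subseteq> V" "U \<times> V \<subseteq> ?W"
      using tube_lemma_right[of S T ?W "topspace T" x] x by blast
    then have "\<bar>c (z, y) - c (x, y)\<bar> \<le> e / 2" if "z \<in> U" "y \<in> topspace T" for z y
      using that by force
    then have "\<bar>T_transform \<epsilon> N c \<psi> z - T_transform \<epsilon> N c \<psi> x\<bar> \<le> e / 2" if "z \<in> U" for z
      using that x openin_subset[OF U(1)]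
      by (intro T_transform_diff_le[OF N T \<open>0 < \<epsilon>\<close> c \<psi>]) auto
    then have "T_transform \<epsilon> N c \<psi> z \<in> ball (T_transform \<epsilon> N c \<psi> x) e" if "z \<in> U" for z
      using that \<open>0 < e\<close> by (fastforce simp: dist_real_def abs_minus_commute)
    then show ?thesis
      using U by blast
  qed
  then show ?thesis
    using Met_TC.continuous_map_to_metric[of S "T_transform \<epsilon> N c \<psi>"] by simp
qed

text \<open>Fubini in the two possible orders. In the inner integral the potential of the outer
  variable factors out, and what remains is the exponential of minus the transform divided by
  \<open>\<epsilon>\<close>.\<close>

lemma integral_exp_T_transform:
  assumes M: "M \<in> borel_probs S" and N: "N \<in> borel_probs T"
    and S: "compact_space S" and T: "compact_space T" and "0 < \<epsilon>"
    and c: "continuous_map (prod_topology S T) euclideanreal c"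
    and \<phi>: "continuous_map S euclideanreal \<phi>"
    and \<psi>: "continuous_map T euclideanreal \<psi>"
  shows "(\<integral>(x, y). exp ((\<phi> x + \<psi> y - c (x, y)) / \<epsilon>) \<partial>(M \<Otimes>\<^sub>M N)) =
    (\<integral>x. exp ((\<phi> x - T_transform \<epsilon> N c \<psi> x) / \<epsilon>) \<partial>M)" (is ?T)
    and "(\<integral>(x, y). exp ((\<phi> x + \<psi> y - c (x, y)) / \<epsilon>) \<partial>(M \<Otimes>\<^sub>M N)) =
    (\<integral>y. exp ((\<psi> y - S_transform \<epsilon> M c \<phi> y) / \<epsilon>) \<partial>N)" (is ?S)
proof -
  interpret M: prob_space M
    using M by (simp add: borel_probs_def)
  interpret N: prob_space N
    using N by (simp add: borel_probs_def)
  interpret pair_sigma_finite M N ..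
  let ?E = "\<lambda>w. exp ((\<phi> (fst w) + \<psi> (snd w) - c w) / \<epsilon>)"
  have "continuous_map (prod_topology S T) euclideanreal (\<lambda>w. \<phi> (fst w))"
    and "continuous_map (prod_topology S T) euclideanreal (\<lambda>w. \<psi> (snd w))"
    using continuous_map_compose[OF continuous_map_fst \<phi>] continuous_map_compose[OF continuous_map_snd \<psi>]
    by (simp_all add: comp_def)
  then have "continuous_map (prod_topology S T) euclideanreal ?E"
    using \<open>0 < \<epsilon>\<close> c by (intro continuous_map_exp continuous_intros) auto
  then have int: "integrable (M \<Otimes>\<^sub>M N) ?E"
    by (rule integrable_continuous_map_prod[OF M N S T])
  have "(\<integral>w. ?E w \<partial>(M \<Otimes>\<^sub>M N)) = (\<integral>x. (\<integral>y. ?E (x, y) \<partial>N) \<partial>M)"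
    by (rule integral_fst'[OF int, symmetric])
  also have "\<dots> = (\<integral>x. exp ((\<phi> x - T_transform \<epsilon> N c \<psi> x) / \<epsilon>) \<partial>M)"
  proof (rule Bochner_Integration.integral_cong[OF refl])
    fix x assume "x \<in> space M"
    then have "continuous_map T euclideanreal (\<lambda>y. c (x, y) - \<psi> y)"
      by (intro continuous_map_diff continuous_map_section[OF c] \<psi>) (simp add: space_borel_probs[OF M])
    from exp_soft_min[OF N T this \<open>0 < \<epsilon>\<close>]
    have "exp ((\<phi> x - T_transform \<epsilon> N c \<psi> x) / \<epsilon>) =
        exp (\<phi> x / \<epsilon>) * (\<integral>y. exp (- (c (x, y) - \<psi> y) / \<epsilon>) \<partial>N)"
      by (simp add: T_transform_eq_soft_min diff_divide_distrib exp_diff exp_minus field_simps)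
    also have "\<dots> = (\<integral>y. exp (\<phi> x / \<epsilon>) * exp (- (c (x, y) - \<psi> y) / \<epsilon>) \<partial>N)"
      by simp
    also have "\<dots> = (\<integral>y. ?E (x, y) \<partial>N)"
      by (simp add: flip: exp_add add_divide_distrib) (simp add: algebra_simps)
    finally show "(\<integral>y. ?E (x, y) \<partial>N) = exp ((\<phi> x - T_transform \<epsilon> N c \<psi> x) / \<epsilon>)" ..
  qed
  finally show ?T
    by (simp add: case_prod_unfold)
  have "(\<integral>w. ?E w \<partial>(M \<Otimes>\<^sub>M N)) = (\<integral>y. (\<integral>x. ?E (x, y) \<partial>M) \<partial>N)"
    using integral_snd[of "\<lambda>x y. ?E (x, y)"] int by (simp add: case_prod_unfold)
  also have "\<dots> = (\<integral>y. exp ((\<psi> y - S_transform \<epsilon> M c \<phi> y) / \<epsilon>) \<partial>N)"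
  proof (rule Bochner_Integration.integral_cong[OF refl])
    fix y assume "y \<in> space N"
    then have "continuous_map S euclideanreal (\<lambda>x. c (x, y) - \<phi> x)"
      using continuous_map_section[OF continuous_map_prod_swap[OF c], of y]
      by (intro continuous_map_diff \<phi>) (simp add: space_borel_probs[OF N])
    from exp_soft_min[OF M S this \<open>0 < \<epsilon>\<close>]
    have "exp ((\<psi> y - S_transform \<epsilon> M c \<phi> y) / \<epsilon>) =
        exp (\<psi> y / \<epsilon>) * (\<integral>x. exp (- (c (x, y) - \<phi> x) / \<epsilon>) \<partial>M)"
      by (simp add: S_transform_eq_T_transform T_transform_eq_soft_min diff_divide_distrib exp_diff
          exp_minus field_simps)
    also have "\<dots> = (\<integral>x. exp (\<psi> y / \<epsilon>) * exp (- (c (x, y) - \<phi> x) / \<epsilon>) \<partial>M)"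
      by simp
    also have "\<dots> = (\<integral>x. ?E (x, y) \<partial>M)"
      by (simp add: flip: exp_add add_divide_distrib) (simp add: algebra_simps)
    finally show "(\<integral>x. ?E (x, y) \<partial>M) = exp ((\<psi> y - S_transform \<epsilon> M c \<phi> y) / \<epsilon>)" ..
  qed
  finally show ?S
    by (simp add: case_prod_unfold)
qed

text \<open>By strict convexity the exponential meets its tangent line at the origin only there.
  This is the equality case used for both blocks.\<close>

lemma exp_minus_1_minus_eq_0_iff: "exp u - 1 - u = 0 \<longleftrightarrow> u = (0::real)"
  using exp_minus_greater[of "- u"] by auto

theorem corollary5p4:
  fixes p :: nat and \<epsilon> :: real
    and X :: "nat \<Rightarrow> 'a metric" and Y :: "'b metric"
    and \<nu> :: "nat \<Rightarrow> 'a measure" and \<eta> :: "'b measure"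
    and c :: "nat \<Rightarrow> 'a \<times> 'b \<Rightarrow> real" and lam :: "nat \<Rightarrow> real"
    and \<phi> :: "nat \<Rightarrow> 'a \<Rightarrow> real" and \<psi> :: "nat \<Rightarrow> 'b \<Rightarrow> real"
  assumes "2 \<le> p" and "0 < \<epsilon>"
    and "\<And>i. i \<in> {1..p} \<Longrightarrow> compact_space (mtopology_of (X i))"
    and "compact_space (mtopology_of Y)"
    and "\<And>i. i \<in> {1..p} \<Longrightarrow> \<nu> i \<in> borel_probs (mtopology_of (X i))"
    and "\<eta> \<in> borel_probs (mtopology_of Y)"
    and "\<And>i. i \<in> {1..p} \<Longrightarrow> spt (mtopology_of (X i)) (\<nu> i) = mspace (X i)"
    and "spt (mtopology_of Y) \<eta> = mspace Y"
    and "\<And>i. i \<in> {1..p} \<Longrightarrow>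
           continuous_map (prod_topology (mtopology_of (X i)) (mtopology_of Y)) euclideanreal (c i)"
    and "\<And>i. i \<in> {1..p} \<Longrightarrow> 0 < lam i"
    and "(\<Sum>i=1..p. lam i) = 1"
    and "is_arg_max (dual_functional p \<epsilon> \<nu> \<eta> c lam)
           (\<lambda>z. z \<in> dual_admissible p X Y lam) (\<phi>, \<psi>)"
  shows "(\<forall>i\<in>{1..p}.
            (\<forall>x\<in>mspace (X i). \<phi> i x = T_transform \<epsilon> \<eta> (c i) (\<psi> i) x) \<and>
            (\<forall>y\<in>mspace Y. \<psi> i y = B_transform p \<epsilon> \<nu> c lam \<phi> i y)) \<and>
         (\<forall>i\<in>{1..p}.
            (\<forall>x\<in>mspace (X i). \<forall>x'\<in>mspace (X i).
               \<bar>\<phi> i x - \<phi> i x'\<bar> \<le> (SUP y\<in>mspace Y. \<bar>c i (x, y) - c i (x', y)\<bar>)) \<and>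
            (\<forall>y\<in>mspace Y. \<forall>y'\<in>mspace Y.
               \<bar>\<psi> i y - \<psi> i y'\<bar> \<le>
                 modulus_Y (X i) (c i) y y' + (\<Sum>j=1..p. lam j * modulus_Y (X j) (c j) y y'))) \<and>
         (\<forall>LX LY :: nat \<Rightarrow> real.
            (\<forall>i\<in>{1..p}.
               (\<forall>y\<in>mspace Y. lipschitz_with (LX i) (X i) (\<lambda>x. c i (x, y))) \<and>
               (\<forall>x\<in>mspace (X i). lipschitz_with (LY i) Y (\<lambda>y. c i (x, y)))) \<longrightarrow>
            (\<forall>i\<in>{1..p}.
               lipschitz_with (LX i) (X i) (\<phi> i) \<and>
               lipschitz_with (LY i + (\<Sum>j=1..p. lam j * LY j)) Y (\<psi> i)))"
proof -

  \<comment> \<open>Continuity of the potentials and of their transforms\<close>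
  let ?I = "{1..p}"
  note pos = \<open>0 < \<epsilon>\<close>
  have X: "compact_space (mtopology_of (X i))" and \<nu>: "\<nu> i \<in> borel_probs (mtopology_of (X i))"
    and \<nu>_full: "spt (mtopology_of (X i)) (\<nu> i) = topspace (mtopology_of (X i))"
    and c: "continuous_map (prod_topology (mtopology_of (X i)) (mtopology_of Y)) euclideanreal (c i)"
    and lam: "0 < lam i" if "i \<in> ?I" for i
    using assms(3,5,7,9,10) that by auto
  note Y = assms(4) and \<eta> = assms(6)
  have \<eta>_full: "spt (mtopology_of Y) \<eta> = topspace (mtopology_of Y)"
    using assms(8) by simp
  have adm: "(\<phi>, \<psi>) \<in> dual_admissible p X Y lam"
    and max: "\<And>z. z \<in> dual_admissible p X Y lam \<Longrightarrow>
      dual_functional p \<epsilon> \<nu> \<eta> c lam z \<le> dual_functional p \<epsilon> \<nu> \<eta> c lam (\<phi>, \<psi>)"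
    using assms(12) unfolding is_arg_max_def by (auto simp: not_less)
  have \<phi>: "continuous_map (mtopology_of (X i)) euclideanreal (\<phi> i)"
    and \<psi>: "continuous_map (mtopology_of Y) euclideanreal (\<psi> i)" if "i \<in> ?I" for i
    using adm that unfolding dual_admissible_def by auto
  have \<psi>_sum: "(\<Sum>i=1..p. lam i * \<psi> i y) = 0" if "y \<in> mspace Y" for y
    using adm that unfolding dual_admissible_def by auto
  define t where "t i = T_transform \<epsilon> \<eta> (c i) (\<psi> i)" for i
  define s where "s i = S_transform \<epsilon> (\<nu> i) (c i) (\<phi> i)" for i
  define b where "b i = B_transform p \<epsilon> \<nu> c lam \<phi> i" for i
  have t: "continuous_map (mtopology_of (X i)) euclideanreal (t i)" if "i \<in> ?I" for i
    unfolding t_def by (rule continuous_map_T_transform[OF \<eta> Y pos c[OF that] \<psi>[OF that]])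
  have s_T: "s i = T_transform \<epsilon> (\<nu> i) (\<lambda>(y, x). c i (x, y)) (\<phi> i)" for i
    by (simp add: s_def S_transform_eq_T_transform fun_eq_iff)
  have s: "continuous_map (mtopology_of Y) euclideanreal (s i)" if "i \<in> ?I" for i
    unfolding s_T
    by (rule continuous_map_T_transform[OF \<nu> X pos continuous_map_prod_swap[OF c] \<phi>]) (rule that)+
  have b_eq: "b i y = s i y - (\<Sum>j=1..p. lam j * s j y)" for i y
    by (simp add: b_def s_def B_transform_def)
  have b: "continuous_map (mtopology_of Y) euclideanreal (b i)" if "i \<in> ?I" for i
    unfolding b_eq using that by (intro continuous_intros s) auto

  \<comment> \<open>The first optimality condition, from the block of potentials on the
    \<open>X i\<close>\<close>
  have \<phi>_eq: "\<phi> i x = t i x" if i: "i \<in> ?I" and x: "x \<in> mspace (X i)" for i x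
  proof -
    define g where "g j z = exp ((\<phi> j z - t j z) / \<epsilon>) - 1 - (\<phi> j z - t j z) / \<epsilon>" for j z
    have g: "continuous_map (mtopology_of (X j)) euclideanreal (g j)" if "j \<in> ?I" for j
      unfolding g_def using pos that by (intro continuous_map_exp continuous_intros \<phi> t) auto
    have g_nonneg: "0 \<le> g j z" for j z
      using exp_ge_add_one_self[of "(\<phi> j z - t j z) / \<epsilon>"] unfolding g_def by linarith
    have J: "dual_functional p \<epsilon> \<nu> \<eta> c lam (f, \<psi>) = (\<Sum>j=1..p. lam j *
        ((\<integral>x. f j x \<partial>(\<nu> j)) - \<epsilon> * (\<integral>x. exp ((f j x - t j x) / \<epsilon>) \<partial>(\<nu> j))))"
      if "\<And>j. j \<in> ?I \<Longrightarrow> continuous_map (mtopology_of (X j)) euclideanreal (f j)" for f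
      unfolding dual_functional_def t_def using that
      by (auto intro!: sum.cong simp: integral_exp_T_transform(1)[OF \<nu> \<eta> X Y pos c _ \<psi>])
    \<comment> \<open>The linear constraint involves \<open>\<psi>\<close> only, so all the
      \<open>\<phi> j\<close> may be replaced by \<open>t j\<close> simultaneously.\<close>
    have "(t, \<psi>) \<in> dual_admissible p X Y lam"
      using t \<psi> \<psi>_sum unfolding dual_admissible_def by auto
    have "(\<Sum>j=1..p. lam j * (\<epsilon> * (\<integral>x. g j x \<partial>(\<nu> j)))) \<le> 0"
    proof -
      \<comment> \<open>After the replacement the exponential integrand is constantly one, with
        integral one under a probability measure. This is the source of the \<open>- 1\<close> in
        \<open>g\<close>.\<close>
      have gain: "((\<integral>x. t j x \<partial>(\<nu> j)) - \<epsilon> * (\<integral>x. exp ((t j x - t j x) / \<epsilon>) \<partial>(\<nu> j)))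
          - ((\<integral>x. \<phi> j x \<partial>(\<nu> j)) - \<epsilon> * (\<integral>x. exp ((\<phi> j x - t j x) / \<epsilon>) \<partial>(\<nu> j)))
          = \<epsilon> * (\<integral>x. g j x \<partial>(\<nu> j))" if j: "j \<in> ?I" for j
      proof -
        interpret prob_space "\<nu> j"
          using \<nu>[OF j] by (simp add: borel_probs_def)
        note int = integrable_continuous_map[OF \<nu>[OF j] X[OF j]]
        have "integrable (\<nu> j) (\<lambda>x. exp ((\<phi> j x - t j x) / \<epsilon>))"
          using pos j by (intro int continuous_map_exp continuous_intros \<phi> t) auto
        then have "(\<integral>x. g j x \<partial>(\<nu> j)) = (\<integral>x. exp ((\<phi> j x - t j x) / \<epsilon>) \<partial>(\<nu> j)) - 1
            - ((\<integral>x. \<phi> j x \<partial>(\<nu> j)) - (\<integral>x. t j x \<partial>(\<nu> j))) / \<epsilon>"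
          using int[OF \<phi>[OF j]] int[OF t[OF j]] unfolding g_def by (simp add: prob_space)
        then have "\<epsilon> * (\<integral>x. g j x \<partial>(\<nu> j)) = \<epsilon> * (\<integral>x. exp ((\<phi> j x - t j x) / \<epsilon>) \<partial>(\<nu> j)) - \<epsilon>
            - ((\<integral>x. \<phi> j x \<partial>(\<nu> j)) - (\<integral>x. t j x \<partial>(\<nu> j)))"
          using pos by (simp add: field_simps)
        then show ?thesis
          by (simp add: prob_space)
      qed
      have "(\<Sum>j=1..p. lam j * (\<epsilon> * (\<integral>x. g j x \<partial>(\<nu> j)))) =
          dual_functional p \<epsilon> \<nu> \<eta> c lam (t, \<psi>) - dual_functional p \<epsilon> \<nu> \<eta> c lam (\<phi>, \<psi>)"
        by (simp only: J[OF \<phi>] J[OF t] sum_subtractf[symmetric] right_diff_distrib[symmetric] gain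
            cong: sum.cong)
      then show ?thesis
        using max[OF \<open>(t, \<psi>) \<in> _\<close>] by linarith
    qed
    \<comment> \<open>The gains are nonnegative and their weighted sum is at most zero by
      maximality, so each one separately is at most zero.\<close>
    moreover have nonneg: "0 \<le> lam j * (\<epsilon> * (\<integral>x. g j x \<partial>(\<nu> j)))" if "j \<in> ?I" for j
      using lam[OF that] pos g_nonneg by (simp add: integral_nonneg_AE)
    ultimately have "lam i * (\<epsilon> * (\<integral>x. g i x \<partial>(\<nu> i))) \<le> 0"
      using i member_le_sum[of i ?I "\<lambda>j. lam j * (\<epsilon> * (\<integral>x. g j x \<partial>(\<nu> j)))"] by force
    then have "(\<integral>x. g i x \<partial>(\<nu> i)) \<le> 0"
      using lam[OF i] pos by (simp add: mult_le_0_iff)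
    then have "g i x = 0"
      using continuous_integral_le_0_imp_eq_0[OF \<nu> X \<nu>_full g g_nonneg, OF i i i i] x by simp
    then show ?thesis
      using exp_minus_1_minus_eq_0_iff[of "(\<phi> i x - t i x) / \<epsilon>"] pos by (simp add: g_def)
  qed

  \<comment> \<open>The second optimality condition, from the constrained block of potentials on
    \<open>Y\<close>\<close>
  have \<psi>_eq: "\<psi> i y = b i y" if i: "i \<in> ?I" and y: "y \<in> mspace Y" for i y
  proof -
    \<comment> \<open>\<open>m z\<close> is the common value of
      \<open>(b j z - s j z) / \<epsilon>\<close> for all \<open>j\<close>, since \<open>b j\<close>
      and \<open>s j\<close> differ by the weighted average of the \<open>s j\<close>. Hence
      \<open>exp (m z)\<close> factors out of the sum over \<open>j\<close>.\<close>
    define m where "m z = - (\<Sum>j=1..p. lam j * s j z) / \<epsilon>" for z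
    define g where "g j z = exp ((\<psi> j z - b j z) / \<epsilon>) - 1 - (\<psi> j z - b j z) / \<epsilon>" for j z
    define G where "G z = exp (m z) * (\<Sum>j=1..p. lam j * g j z)" for z
    \<comment> \<open>The weights sum to one, so subtracting the average enforces the constraint.
      This makes \<open>(\<phi>, b)\<close> an admissible competitor.\<close>
    have b_sum: "(\<Sum>j=1..p. lam j * b j z) = 0" for z
      using assms(11) by (simp add: b_eq right_diff_distrib sum_subtractf flip: sum_distrib_right)
    have g_nonneg: "0 \<le> g j z" for j z
      using exp_ge_add_one_self[of "(\<psi> j z - b j z) / \<epsilon>"] unfolding g_def by linarith
    have g_term: "0 \<le> lam j * g j z" if "j \<in> ?I" for j z
      using lam[OF that] g_nonneg[of j z] by simp
    have G_nonneg: "0 \<le> G z" for z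
      unfolding G_def by (intro mult_nonneg_nonneg sum_nonneg g_term) auto
    have "continuous_map (mtopology_of Y) euclideanreal (g j)" if "j \<in> ?I" for j
      unfolding g_def using pos that by (intro continuous_map_exp continuous_intros \<psi> b) auto
    moreover have "continuous_map (mtopology_of Y) euclideanreal m"
      unfolding m_def using pos by (intro continuous_intros s) auto
    ultimately have G: "continuous_map (mtopology_of Y) euclideanreal G"
      unfolding G_def by (intro continuous_map_exp continuous_intros) auto
    \<comment> \<open>\<open>G\<close> is the difference of the integrands for \<open>\<psi>\<close>
      and for \<open>b\<close>. The linear terms of the \<open>g j\<close> drop out because both
      families satisfy the constraint, and the terms \<open>- 1\<close> produce the sum for
      \<open>b\<close>.\<close>
    have G_eq: "G z = (\<Sum>j=1..p. lam j * exp ((\<psi> j z - s j z) / \<epsilon>))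
        - (\<Sum>j=1..p. lam j * exp ((b j z - s j z) / \<epsilon>))" if "z \<in> mspace Y" for z
    proof -
      have m: "(b j z - s j z) / \<epsilon> = m z" for j
        by (simp add: b_eq m_def)
      have "exp ((\<psi> j z - s j z) / \<epsilon>) = exp (m z) * exp ((\<psi> j z - b j z) / \<epsilon>)" for j
        by (simp add: m[of j, symmetric] diff_divide_distrib flip: exp_add)
      moreover have "(\<Sum>j=1..p. lam j * ((\<psi> j z - b j z) / \<epsilon>)) = 0"
        using \<psi>_sum[OF that] b_sum[of z]
        by (simp add: right_diff_distrib sum_subtractf flip: sum_divide_distrib)
      ultimately show ?thesis
        unfolding G_def g_def m
        by (simp add: right_diff_distrib sum_subtractf sum_distrib_left mult.left_commute mult.commute)
    qed
    have J: "dual_functional p \<epsilon> \<nu> \<eta> c lam (\<phi>, f) = (\<Sum>j=1..p. lam j * (\<integral>x. \<phi> j x \<partial>(\<nu> j)))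
        - \<epsilon> * (\<integral>z. (\<Sum>j=1..p. lam j * exp ((f j z - s j z) / \<epsilon>)) \<partial>\<eta>)"
      and int: "integrable \<eta> (\<lambda>z. \<Sum>j=1..p. lam j * exp ((f j z - s j z) / \<epsilon>))"
      if f: "\<And>j. j \<in> ?I \<Longrightarrow> continuous_map (mtopology_of Y) euclideanreal (f j)" for f
    proof -
      have i: "integrable \<eta> (\<lambda>z. lam j * exp ((f j z - s j z) / \<epsilon>))" if "j \<in> ?I" for j
        using pos that
        by (intro integrable_continuous_map[OF \<eta> Y] continuous_map_exp continuous_intros f s) auto
      then show "integrable \<eta> (\<lambda>z. \<Sum>j=1..p. lam j * exp ((f j z - s j z) / \<epsilon>))"
        by (intro Bochner_Integration.integrable_sum)
      have "(\<integral>z. (\<Sum>j=1..p. lam j * exp ((f j z - s j z) / \<epsilon>)) \<partial>\<eta>)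
          = (\<Sum>j=1..p. lam j * (\<integral>z. exp ((f j z - s j z) / \<epsilon>) \<partial>\<eta>))"
        using i by (subst Bochner_Integration.integral_sum) auto
      moreover have "dual_functional p \<epsilon> \<nu> \<eta> c lam (\<phi>, f) = (\<Sum>j=1..p. lam j *
        ((\<integral>x. \<phi> j x \<partial>(\<nu> j)) - \<epsilon> * (\<integral>z. exp ((f j z - s j z) / \<epsilon>) \<partial>\<eta>)))"
        unfolding dual_functional_def s_def using f
        by (auto intro!: sum.cong simp: integral_exp_T_transform(2)[OF \<nu> \<eta> X Y pos c \<phi>])
      ultimately show "dual_functional p \<epsilon> \<nu> \<eta> c lam (\<phi>, f) =
          (\<Sum>j=1..p. lam j * (\<integral>x. \<phi> j x \<partial>(\<nu> j)))
          - \<epsilon> * (\<integral>z. (\<Sum>j=1..p. lam j * exp ((f j z - s j z) / \<epsilon>)) \<partial>\<eta>)"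
        by (simp add: right_diff_distrib sum_subtractf sum_distrib_left mult.left_commute)
    qed
    have "(\<phi>, b) \<in> dual_admissible p X Y lam"
      using \<phi> b b_sum unfolding dual_admissible_def by auto
    \<comment> \<open>The integrals of the \<open>\<phi> j\<close> are the same on both sides, and
      the factor \<open>- \<epsilon>\<close> reverses the inequality.\<close>
    from max[OF this]
    have "(\<integral>z. (\<Sum>j=1..p. lam j * exp ((\<psi> j z - s j z) / \<epsilon>)) \<partial>\<eta>)
        \<le> (\<integral>z. (\<Sum>j=1..p. lam j * exp ((b j z - s j z) / \<epsilon>)) \<partial>\<eta>)"
      unfolding J[of b, OF b, simplified] J[of \<psi>, OF \<psi>, simplified] using pos by simp
    moreover have "(\<integral>z. G z \<partial>\<eta>) = (\<integral>z. (\<Sum>j=1..p. lam j * exp ((\<psi> j z - s j z) / \<epsilon>))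
        - (\<Sum>j=1..p. lam j * exp ((b j z - s j z) / \<epsilon>)) \<partial>\<eta>)"
      by (intro Bochner_Integration.integral_cong) (auto simp: G_eq space_borel_probs[OF \<eta>])
    moreover have "\<dots> = (\<integral>z. (\<Sum>j=1..p. lam j * exp ((\<psi> j z - s j z) / \<epsilon>)) \<partial>\<eta>)
        - (\<integral>z. (\<Sum>j=1..p. lam j * exp ((b j z - s j z) / \<epsilon>)) \<partial>\<eta>)"
      by (rule Bochner_Integration.integral_diff[OF int[OF \<psi>] int[OF b]])
    ultimately have "G y = 0"
      using continuous_integral_le_0_imp_eq_0[OF \<eta> Y \<eta>_full G G_nonneg] y by simp
    then have "(\<Sum>j=1..p. lam j * g j y) = 0"
      by (simp add: G_def)
    then have "lam i * g i y = 0"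
      using i g_term by (subst (asm) sum_nonneg_eq_0_iff) auto
    then have "g i y = 0"
      using lam[OF i] by simp
    then show ?thesis
      using exp_minus_1_minus_eq_0_iff[of "(\<psi> i y - b i y) / \<epsilon>"] pos by (simp add: g_def)
  qed

  \<comment> \<open>Moduli of continuity inherited from the costs\<close>
  have \<phi>_mod: "\<bar>\<phi> i x - \<phi> i x'\<bar> \<le> (SUP y\<in>mspace Y. \<bar>c i (x, y) - c i (x', y)\<bar>)"
    if i: "i \<in> ?I" and x: "x \<in> mspace (X i)" "x' \<in> mspace (X i)" for i x x'
    using T_transform_diff_le_SUP[OF \<eta> Y pos c[OF i] \<psi>[OF i], of x x'] x
    by (simp add: \<phi>_eq[OF i] t_def)
  have s_mod: "\<bar>s i y - s i y'\<bar> \<le> modulus_Y (X i) (c i) y y'"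
    if i: "i \<in> ?I" and y: "y \<in> mspace Y" "y' \<in> mspace Y" for i y y'
    using T_transform_diff_le_SUP[OF \<nu>[OF i] X[OF i] pos continuous_map_prod_swap[OF c[OF i]] \<phi>[OF i],
        of y y'] y
    by (simp add: s_T modulus_Y_def)
  have \<psi>_mod: "\<bar>\<psi> i y - \<psi> i y'\<bar> \<le>
      modulus_Y (X i) (c i) y y' + (\<Sum>j=1..p. lam j * modulus_Y (X j) (c j) y y')"
    if i: "i \<in> ?I" and y: "y \<in> mspace Y" "y' \<in> mspace Y" for i y y'
  proof -
    \<comment> \<open>The transform with index \<open>i\<close> contributes the first modulus, and
      the subtracted average contributes the weighted sum.\<close>
    have "\<psi> i y - \<psi> i y' = (s i y - s i y') - (\<Sum>j=1..p. lam j * (s j y - s j y'))"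
      by (simp add: \<psi>_eq[OF i] y b_eq right_diff_distrib sum_subtractf)
    moreover have "\<bar>\<Sum>j=1..p. lam j * (s j y - s j y')\<bar> \<le> (\<Sum>j=1..p. lam j * modulus_Y (X j) (c j) y y')"
      using lam s_mod[OF _ y] by (intro order_trans[OF sum_abs] sum_mono)
        (simp add: abs_mult less_imp_le mult_left_mono)
    ultimately show ?thesis
      using s_mod[OF i y] by linarith
  qed

  \<comment> \<open>Lipschitz bounds\<close>
  \<comment> \<open>A probability measure lives on a nonempty space. Nonemptiness is required to
    bound a real supremum from above by a common bound of its terms.\<close>
  have X_ne: "mspace (X i) \<noteq> {}" if "i \<in> ?I" for i
    using prob_space.not_empty[of "\<nu> i"] \<nu>[OF that] space_borel_probs[OF \<nu>[OF that]]
    by (auto simp: borel_probs_def)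
  have Y_ne: "mspace Y \<noteq> {}"
    using prob_space.not_empty[of \<eta>] \<eta> space_borel_probs[OF \<eta>] by (auto simp: borel_probs_def)
  have "lipschitz_with (LX i) (X i) (\<phi> i) \<and>
      lipschitz_with (LY i + (\<Sum>j=1..p. lam j * LY j)) Y (\<psi> i)"
    if L: "\<And>i. i \<in> ?I \<Longrightarrow> (\<forall>y\<in>mspace Y. lipschitz_with (LX i) (X i) (\<lambda>x. c i (x, y))) \<and>
        (\<forall>x\<in>mspace (X i). lipschitz_with (LY i) Y (\<lambda>y. c i (x, y)))" and i: "i \<in> ?I"
    for LX LY :: "nat \<Rightarrow> real" and i
  proof
    \<comment> \<open>Nonnegativity is part of \<open>lipschitz_with\<close>, but the hypothesis
      offers it only at points of the other space; one existing point there suffices.\<close>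
    have LX: "0 \<le> LX i" and LY: "0 \<le> LY j" if "j \<in> ?I" for j
      using L[OF i] L[OF that] X_ne[OF that] Y_ne unfolding lipschitz_with_def by blast+
    have "(SUP y\<in>mspace Y. \<bar>c i (x, y) - c i (x', y)\<bar>) \<le> LX i * mdist (X i) x x'"
      if "x \<in> mspace (X i)" "x' \<in> mspace (X i)" for x x'
      using L[OF i] that Y_ne by (intro cSUP_least) (auto simp: lipschitz_with_def)
    then show "lipschitz_with (LX i) (X i) (\<phi> i)"
      using LX[OF i] \<phi>_mod[OF i] unfolding lipschitz_with_def by (meson order_trans)
    have mod: "modulus_Y (X j) (c j) y y' \<le> LY j * mdist Y y y'"
      if "j \<in> ?I" "y \<in> mspace Y" "y' \<in> mspace Y" for j y y'
      unfolding modulus_Y_def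
      using L[OF that(1)] that X_ne by (intro cSUP_least) (auto simp: lipschitz_with_def)
    have "\<bar>\<psi> i y - \<psi> i y'\<bar> \<le> (LY i + (\<Sum>j=1..p. lam j * LY j)) * mdist Y y y'"
      if y: "y \<in> mspace Y" "y' \<in> mspace Y" for y y'
    proof -
      have "(\<Sum>j=1..p. lam j * modulus_Y (X j) (c j) y y') \<le> (\<Sum>j=1..p. lam j * (LY j * mdist Y y y'))"
        using lam mod[OF _ y] by (intro sum_mono mult_left_mono) (auto intro: less_imp_le)
      then show ?thesis
        using \<psi>_mod[OF i y] mod[OF i y] by (simp add: distrib_right sum_distrib_right mult.assoc)
    qed
    moreover have "0 \<le> LY i + (\<Sum>j=1..p. lam j * LY j)"
      using lam LY i by (intro add_nonneg_nonneg sum_nonneg mult_nonneg_nonneg) (auto intro: less_imp_le)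
    ultimately show "lipschitz_with (LY i + (\<Sum>j=1..p. lam j * LY j)) Y (\<psi> i)"
      by (simp add: lipschitz_with_def)
  qed
  then show ?thesis
    using \<phi>_eq \<psi>_eq \<phi>_mod \<psi>_mod unfolding t_def b_def by blast
qed

end
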